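(* Let $\lambda$ be an infinite cardinal and $S=\mathscr{I}^{\infty}_\lambda$ the inverse semigroup of injective partial selfmaps of $\lambda$ that are almost everywhere the identity. Then the following hold. (i) An element $\alpha\in S$ is an idempotent if and only if $(x)\alpha=x$ for every $x\in\operatorname{dom}\alpha$. (ii) If $\varepsilon,\iota\in E(S)$, then $\varepsilon\leqslant\iota$ if and only if $\operatorname{dom}\varepsilon\subseteq\operatorname{dom}\iota$. (iii) The semilattice $E(S)$ is isomorphic to $(\mathscr{P}_{<\omega}(\lambda),\cup)$ under the mapping $(\varepsilon)h=\lambda\setminus\operatorname{dom}\varepsilon$. (iv) Every maximal chain in $E(S)$ is an $\omega$-chain. (v) For $\alpha,\beta\in S$: $\alpha\mathscr{R}\beta$ if and only if $\operatorname{dom}\alpha=\operatorname{dom}\beta$. (vi) For $\alpha,\beta\in S$: $\alpha\mathscr{L}\beta$ if and only if $\operatorname{ran}\alpha=\operatorname{ran}\beta$. (vii) For $\alpha,\beta\in S$: $\alpha\mathscr{H}\beta$ if and only if $\operatorname{dom}\alpha=\operatorname{dom}\beta$ and $\operatorname{ran}\alpha=\operatorname{ran}\beta$. (viii) For $\alpha,\beta\in S$: $\alpha\mathscr{D}\beta$ if and only if $|\lambda\setminus\operatorname{dom}\alpha|=|\lambda\setminus\operatorname{dom}\beta|$. (ix) If $n$ is a non-negative integer, then for every $\alpha,\beta\in S$ such that $|\lambda\setminus\operatorname{dom}\alpha|=|\lambda\setminus\operatorname{dom}\beta|=n$ there exist $\gamma,\delta\in S$ such that $\alpha=\gamma\cdot\beta\cdot\delta$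 and $|\lambda\setminus\operatorname{dom}\gamma|=|\lambda\setminus\operatorname{dom}\delta|=n$. (x) For every non-negative integer $n$ the set $I_n=\{\alpha\in S\mid|\lambda\setminus\operatorname{dom}\alpha|\geqslant n\}$ is an ideal in $S$. Moreover, for every ideal $I$ in $S$ there exists an integer $n\geqslant 0$ such that $I=I_n$. (xi) $\mathscr{D}=\mathscr{J}$ in $S$. (xii) If $\lambda_1$ and $\lambda_2$ are infinite cardinals such that $\lambda_1\leqslant\lambda_2$, then $\mathscr{I}^{\infty}_{\lambda_1}$ is, up to isomorphism, a subsemigroup of $\mathscr{I}^{\infty}_{\lambda_2}$ (i.e. there is an injective semigroup homomorphism $\mathscr{I}^{\infty}_{\lambda_1}\to\mathscr{I}^{\infty}_{\lambda_2}$). (xiii) $(\mathscr{I}^{\infty}_{\lambda}/\mathscr{J},\preccurlyeq)$ is an $\omega$-chain for any infinite cardinal $\lambda$.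
   Context: For an infinite cardinal $\lambda$ (regarded as a set), $\mathscr{I}_\lambda$ is the symmetric inverse semigroup of all partial one-to-one maps from $\lambda$ to $\lambda$; maps are written on the right and composed left to right: $(x)(\alpha\beta)=((x)\alpha)\beta$ for $x\in\operatorname{dom}(\alpha\beta)=\{y\in\operatorname{dom}\alpha\mid (y)\alpha\in\operatorname{dom}\beta\}$. A map $\alpha\in\mathscr{I}_\lambda$ is almost everywhere the identity if $\lambda\setminus\operatorname{dom}\alpha$ is finite and $(x)\alpha\neq x$ only for finitely many $x\in\operatorname{dom}\alpha$. $\mathscr{I}^{\infty}_\lambda\subseteq\mathscr{I}_\lambda$ is the inverse subsemigroup of all such maps. For an inverse semigroup $S$, $E(S)$ is its semilattice of idempotents with the natural order $e\leqslant f\iff ef=fe=e$. A chain is a linearly ordered semilattice (or partially ordered set); a maximal chain is one not properly contained in another chain; an $\omega$-chain is a chain isomorphic to $\{0,-1,-2,-3,\ldots\}$ with the usual order. $\mathscr{P}_{<\omega}(\lambda)$ is the set of all finite subsets of $\lambda$, a semilattice under union. Green's relations on a semigroup $S$ ($S^1$ is $S$ with adjoined unit): $a\mathscr{R}b\iff aS^1=bS^1$; $a\mathscr{L}b\iff S^1a=S^1b$; $a\mathscr{J}b\iff S^1aS^1=S^1bS^1$; $\mathscr{D}=\mathscr{L}\circ\mathscr{R}=\mathscr{R}\circ\mathscr{L}$; $\mathscr{H}=\mathscr{L}\cap\mathscr{R}$. On the set $S/\mathscr{J}$ of $\mathscr{J}$-classes, $J_a\preccurlyeq J_b\iff S^1aS^1\subseteq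 S^1bS^1$. "Ideal" means non-empty two-sided ideal. *)

theory Defs
  imports "HOL-Algebra.Coset"
begin

unbundle cardinal_syntax

section \<open>Semigroups with a carrier\<close>

text \<open>
  Semigroups are given as records of HOL-Algebra. The notions of this section use only the fields
  \<open>carrier\<close> and \<open>mult\<close>; the field \<open>one\<close> is ignored, as it is by \<^const>\<open>hom\<close>, \<^const>\<open>mon\<close> and
  \<^const>\<open>iso\<close>, which are therefore notions of semigroup morphism.
\<close>

definition idempotents :: "('a, 'b) monoid_scheme \<Rightarrow> 'a set" where
  "idempotents S = {e \<in> carrier S. e \<otimes>\<^bsub>S\<^esub> e = e}"

definition natural_le :: "('a, 'b) monoid_scheme \<Rightarrow> 'a \<Rightarrow> 'a \<Rightarrow> bool" where
  "natural_le S e f \<longleftrightarrow> e \<otimes>\<^bsub>S\<^esub> f = e \<and> f \<otimes>\<^bsub>S\<^esub> e = e"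

definition idempotent_semilattice :: "('a, 'b) monoid_scheme \<Rightarrow> ('a, 'b) monoid_scheme" where
  "idempotent_semilattice S = S\<lparr>carrier := idempotents S\<rparr>"

text \<open>
  The semigroup \<open>S\<^sup>1\<close>: an element \<open>a\<close> of \<open>S\<close> appears as \<open>Some a\<close>, the new unit is \<open>None\<close>. The unit is
  adjoined even if \<open>S\<close> already has one; this does not affect the principal ideals below.
\<close>

definition adjoin_unit :: "('a, 'b) monoid_scheme \<Rightarrow> 'a option monoid" where
  "adjoin_unit S =
     \<lparr>carrier = insert None (Some ` carrier S),
      mult = (\<lambda>x y. case x of None \<Rightarrow> y | Some a \<Rightarrow>
                    (case y of None \<Rightarrow> x | Some b \<Rightarrow> Some (a \<otimes>\<^bsub>S\<^esub> b))),
      one = None\<rparr>"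

definition principal_right_ideal :: "('a, 'b) monoid_scheme \<Rightarrow> 'a \<Rightarrow> 'a option set" where
  "principal_right_ideal S a = Some a <#\<^bsub>adjoin_unit S\<^esub> carrier (adjoin_unit S)"

definition principal_left_ideal :: "('a, 'b) monoid_scheme \<Rightarrow> 'a \<Rightarrow> 'a option set" where
  "principal_left_ideal S a = carrier (adjoin_unit S) #>\<^bsub>adjoin_unit S\<^esub> Some a"

definition principal_ideal :: "('a, 'b) monoid_scheme \<Rightarrow> 'a \<Rightarrow> 'a option set" where
  "principal_ideal S a =
     (carrier (adjoin_unit S) #>\<^bsub>adjoin_unit S\<^esub> Some a) <#>\<^bsub>adjoin_unit S\<^esub> carrier (adjoin_unit S)"

definition green_R :: "('a, 'b) monoid_scheme \<Rightarrow> 'a rel" where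
  "green_R S = {(a, b). a \<in> carrier S \<and> b \<in> carrier S \<and>
                        principal_right_ideal S a = principal_right_ideal S b}"

definition green_L :: "('a, 'b) monoid_scheme \<Rightarrow> 'a rel" where
  "green_L S = {(a, b). a \<in> carrier S \<and> b \<in> carrier S \<and>
                        principal_left_ideal S a = principal_left_ideal S b}"

definition green_J :: "('a, 'b) monoid_scheme \<Rightarrow> 'a rel" where
  "green_J S = {(a, b). a \<in> carrier S \<and> b \<in> carrier S \<and>
                        principal_ideal S a = principal_ideal S b}"

definition green_H :: "('a, 'b) monoid_scheme \<Rightarrow> 'a rel" where
  "green_H S = green_L S \<inter> green_R S"

definition green_D :: "('a, 'b) monoid_scheme \<Rightarrow> 'a rel" where
  "green_D S = green_L S O green_R S"

definition J_class_le :: "('a, 'b) monoid_scheme \<Rightarrow> 'a set \<Rightarrow> 'a set \<Rightarrow> bool" where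
  "J_class_le S A B \<longleftrightarrow>
     (\<exists>a \<in> carrier S. \<exists>b \<in> carrier S. A = green_J S `` {a} \<and> B = green_J S `` {b} \<and>
        principal_ideal S a \<subseteq> principal_ideal S b)"

definition semigroup_ideal :: "('a, 'b) monoid_scheme \<Rightarrow> 'a set \<Rightarrow> bool" where
  "semigroup_ideal S I \<longleftrightarrow> I \<noteq> {} \<and> I \<subseteq> carrier S \<and>
     (\<forall>a \<in> I. \<forall>s \<in> carrier S. s \<otimes>\<^bsub>S\<^esub> a \<in> I \<and> a \<otimes>\<^bsub>S\<^esub> s \<in> I)"

definition is_omega_chain :: "'a set \<Rightarrow> ('a \<Rightarrow> 'a \<Rightarrow> bool) \<Rightarrow> bool" where
  "is_omega_chain C leq \<longleftrightarrow>
     (\<exists>f. bij_betw f C {..0::int} \<and> (\<forall>x \<in> C. \<forall>y \<in> C. leq x y \<longleftrightarrow> f x \<le> f y))"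

definition finite_subsets_semilattice :: "'a set \<Rightarrow> 'a set monoid" where
  "finite_subsets_semilattice X = \<lparr>carrier = Fpow X, mult = (\<union>), one = {}\<rparr>"


section \<open>Partial injective maps\<close>

text \<open>
  Maps act on the right, so the product of \<open>\<alpha>\<close> and \<open>\<beta>\<close> applies \<open>\<alpha>\<close> first.
\<close>

definition sym_inverse_semigroup :: "'a set \<Rightarrow> ('a \<rightharpoonup> 'a) monoid" where
  "sym_inverse_semigroup X =
     \<lparr>carrier = {\<alpha>. dom \<alpha> \<subseteq> X \<and> ran \<alpha> \<subseteq> X \<and> inj_on \<alpha> (dom \<alpha>)},
      mult = (\<lambda>\<alpha> \<beta>. \<beta> \<circ>\<^sub>m \<alpha>),
      one = Some |` X\<rparr>"

definition almost_everywhere_identity :: "'a set \<Rightarrow> ('a \<rightharpoonup> 'a) \<Rightarrow> bool" where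
  "almost_everywhere_identity X \<alpha> \<longleftrightarrow>
     finite (X - dom \<alpha>) \<and> finite {x \<in> dom \<alpha>. \<alpha> x \<noteq> Some x}"

definition almost_identity_semigroup :: "'a set \<Rightarrow> ('a \<rightharpoonup> 'a) monoid" where
  "almost_identity_semigroup X = (sym_inverse_semigroup X)
     \<lparr>carrier := {\<alpha> \<in> carrier (sym_inverse_semigroup X). almost_everywhere_identity X \<alpha>}\<rparr>"

lemma monoid_almost_identity_semigroup: "monoid (almost_identity_semigroup X)"
proof (rule monoidI)
  let ?S = "almost_identity_semigroup X"
  show "\<one>\<^bsub>?S\<^esub> \<in> carrier ?S"
    by (auto simp: almost_identity_semigroup_def sym_inverse_semigroup_def
        almost_everywhere_identity_def restrict_map_def inj_on_def ran_def dom_def)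
  fix \<alpha> \<beta> assume a: "\<alpha> \<in> carrier ?S" and b: "\<beta> \<in> carrier ?S"
  have ia: "inj_on \<alpha> (dom \<alpha>)" and ib: "inj_on \<beta> (dom \<beta>)" and ra: "ran \<alpha> \<subseteq> X"
    and fin: "finite (X - dom \<alpha>)" "finite {x \<in> dom \<alpha>. \<alpha> x \<noteq> Some x}"
      "finite (X - dom \<beta>)" "finite {x \<in> dom \<beta>. \<beta> x \<noteq> Some x}"
    and sub: "dom \<alpha> \<subseteq> X" "dom \<beta> \<subseteq> X" "ran \<beta> \<subseteq> X"
    using a b by (auto simp: almost_identity_semigroup_def sym_inverse_semigroup_def
        almost_everywhere_identity_def)
  let ?F = "(X - dom \<alpha>) \<union> {x \<in> dom \<alpha>. \<alpha> x \<noteq> Some x} \<union> (X - dom \<beta>) \<union> {x \<in> dom \<beta>. \<beta> x \<noteq> Some x}"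
  have F: "finite ?F" using fin by blast
  have "X - dom (\<beta> \<circ>\<^sub>m \<alpha>) \<subseteq> ?F"
    by (auto simp: map_comp_def dom_def split: option.splits)
  moreover have "{x \<in> dom (\<beta> \<circ>\<^sub>m \<alpha>). (\<beta> \<circ>\<^sub>m \<alpha>) x \<noteq> Some x} \<subseteq> ?F"
    by (auto simp: map_comp_def dom_def split: option.splits)
  moreover have "inj_on (\<beta> \<circ>\<^sub>m \<alpha>) (dom (\<beta> \<circ>\<^sub>m \<alpha>))"
  proof (rule inj_onI)
    fix x y assume "x \<in> dom (\<beta> \<circ>\<^sub>m \<alpha>)" "y \<in> dom (\<beta> \<circ>\<^sub>m \<alpha>)" and e: "(\<beta> \<circ>\<^sub>m \<alpha>) x = (\<beta> \<circ>\<^sub>m \<alpha>) y"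
    then obtain u v where uv: "\<alpha> x = Some u" "\<alpha> y = Some v" "u \<in> dom \<beta>" "v \<in> dom \<beta>"
      by (fastforce simp: map_comp_Some_iff)
    with e have "\<beta> u = \<beta> v" by (simp add: map_comp_def)
    with ib uv have "u = v" by (simp add: inj_on_eq_iff)
    with uv have "\<alpha> x = \<alpha> y" "x \<in> dom \<alpha>" "y \<in> dom \<alpha>" by auto
    with ia show "x = y" by (rule inj_onD)
  qed
  moreover have "dom (\<beta> \<circ>\<^sub>m \<alpha>) \<subseteq> X"
    using sub(1) by (auto simp: map_comp_def dom_def split: option.splits)
  moreover have "ran (\<beta> \<circ>\<^sub>m \<alpha>) \<subseteq> X"
    using sub(3) by (auto simp: map_comp_def ran_def split: option.splits)
  ultimately show "\<alpha> \<otimes>\<^bsub>?S\<^esub> \<beta> \<in> carrier ?S"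
    using finite_subset[OF _ F]
    by (auto simp: almost_identity_semigroup_def sym_inverse_semigroup_def
        almost_everywhere_identity_def)
next
  let ?S = "almost_identity_semigroup X"
  fix \<alpha> \<beta> \<gamma>
  show "\<alpha> \<otimes>\<^bsub>?S\<^esub> \<beta> \<otimes>\<^bsub>?S\<^esub> \<gamma> = \<alpha> \<otimes>\<^bsub>?S\<^esub> (\<beta> \<otimes>\<^bsub>?S\<^esub> \<gamma>)"
    by (auto simp: almost_identity_semigroup_def sym_inverse_semigroup_def map_comp_def fun_eq_iff
        split: option.splits)
next
  let ?S = "almost_identity_semigroup X"
  fix \<alpha> assume "\<alpha> \<in> carrier ?S"
  then have *: "x \<in> X \<and> y \<in> X" if "\<alpha> x = Some y" for x y
    using that by (auto simp: almost_identity_semigroup_def sym_inverse_semigroup_def ran_def)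
  have "(\<alpha> \<circ>\<^sub>m (Some |` X)) x = \<alpha> x \<and> ((Some |` X) \<circ>\<^sub>m \<alpha>) x = \<alpha> x" for x
    by (cases "\<alpha> x") (auto simp: map_comp_def restrict_map_def dest: *)
  then have "\<alpha> \<circ>\<^sub>m (Some |` X) = \<alpha>" "(Some |` X) \<circ>\<^sub>m \<alpha> = \<alpha>" by auto
  then show "\<one>\<^bsub>?S\<^esub> \<otimes>\<^bsub>?S\<^esub> \<alpha> = \<alpha>" "\<alpha> \<otimes>\<^bsub>?S\<^esub> \<one>\<^bsub>?S\<^esub> = \<alpha>"
    by (simp_all add: almost_identity_semigroup_def sym_inverse_semigroup_def)
qed

end

theory Submission
  imports Defs
begin

text \<open>An element of \<open>S\<close> differs from the identity at finitely many points only,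
  so it is governed by one natural number, its defect: the number of points missing from its domain.
  Three facts about the defect carry almost everything. The range misses as many points as the
  domain (\<open>card_compl_ran\<close>), because the whole discrepancy with the identity sits
  inside a finite set. A product has at least the defect of each factor
  (\<open>mult_defect\<close>). And any two finite sets of equal size are the complements of the
  domain and of the range of some element (\<open>ex_dom_ran\<close>).

  From these, \<open>factorization\<close> writes \<open>\<alpha>\<close> as
  \<open>\<gamma>\<beta>\<delta>\<close> whenever the defect of \<open>\<beta>\<close> is at most
  that of \<open>\<alpha>\<close>. Hence inclusion of principal two-sided ideals is reverse
  comparison of defects: the J-classes are the levels of the defect and form an omega-chain, and an
  ideal consists of all elements whose defect is at least the least one occurring in it. Inverses
  turn one-sided divisibility into inclusion of domains or of ranges, which settles R, L and H. An
  element with the range of \<open>\<alpha>\<close> and the domain of \<open>\<beta>\<close> exists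
  exactly when the defects agree, so D equals J.

  Idempotents are the identities of cofinite subsets, and multiplying them intersects these subsets;
  complements turn this into union of finite sets, with the natural order becoming reverse
  inclusion. A maximal chain of finite subsets has a member of every size
  (\<open>maxchain_Fpow_card_surj\<close>), and only one, since comparable finite sets of equal size
  coincide. For the embedding, maps are carried along an injection and completed by the identity
  (\<open>extend_along_mon\<close>).\<close>

section \<open>Green's relations in a monoid\<close>

context monoid
begin

text \<open>The adjoined unit contributes only \<open>Some a\<close>, which the unit of the monoid
  already yields as \<open>a \<otimes> \<one>\<close>; the same remark disposes of it for left and
  two-sided ideals.\<close>

lemma principal_right_ideal_eq:
  assumes "a \<in> carrier G"
  shows "principal_right_ideal G a = (\<lambda>s. Some (a \<otimes> s)) ` carrier G"
proof -
  have "principal_right_ideal G a = insert (Some a) ((\<lambda>s. Some (a \<otimes> s)) ` carrier G)"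
    by (auto simp: principal_right_ideal_def l_coset_def adjoin_unit_def)
  moreover have "Some a \<in> (\<lambda>s. Some (a \<otimes> s)) ` carrier G"
    using assms by (intro image_eqI[of _ _ \<one>]) auto
  ultimately show ?thesis by (simp add: insert_absorb)
qed

lemma principal_left_ideal_eq:
  assumes "a \<in> carrier G"
  shows "principal_left_ideal G a = (\<lambda>s. Some (s \<otimes> a)) ` carrier G"
proof -
  have "principal_left_ideal G a = insert (Some a) ((\<lambda>s. Some (s \<otimes> a)) ` carrier G)"
    by (auto simp: principal_left_ideal_def r_coset_def adjoin_unit_def)
  moreover have "Some a \<in> (\<lambda>s. Some (s \<otimes> a)) ` carrier G"
    using assms by (intro image_eqI[of _ _ \<one>]) auto
  ultimately show ?thesis by (simp add: insert_absorb)
qed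

lemma principal_ideal_eq:
  assumes a: "a \<in> carrier G"
  shows "principal_ideal G a = (\<lambda>(s, t). Some (s \<otimes> a \<otimes> t)) ` (carrier G \<times> carrier G)"
    (is "_ = ?I")
proof -
  have "principal_ideal G a = principal_left_ideal G a \<union> ?I"
    unfolding principal_ideal_def principal_left_ideal_def[symmetric] principal_left_ideal_eq[OF a]
    by (auto simp: set_mult_def adjoin_unit_def)
  moreover have "principal_left_ideal G a \<subseteq> ?I"
  proof
    fix x assume "x \<in> principal_left_ideal G a"
    then obtain s where "s \<in> carrier G" "x = Some (s \<otimes> a)"
      using principal_left_ideal_eq[OF a] by blast
    then show "x \<in> ?I"
      using a by (intro image_eqI[of _ _ "(s, \<one>)"]) auto
  qed
  ultimately show ?thesis by blast
qed

lemma principal_right_ideal_subset_iff: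
  assumes a: "a \<in> carrier G" and b: "b \<in> carrier G"
  shows "principal_right_ideal G a \<subseteq> principal_right_ideal G b \<longleftrightarrow> (\<exists>s \<in> carrier G. a = b \<otimes> s)"
proof
  assume "principal_right_ideal G a \<subseteq> principal_right_ideal G b"
  moreover have "Some a \<in> principal_right_ideal G a"
    using a by (simp add: principal_right_ideal_eq image_iff) (metis one_closed r_one)
  ultimately show "\<exists>s \<in> carrier G. a = b \<otimes> s"
    using principal_right_ideal_eq[OF b] by auto
next
  assume "\<exists>s \<in> carrier G. a = b \<otimes> s"
  then show "principal_right_ideal G a \<subseteq> principal_right_ideal G b"
    using b m_assoc by (auto simp: principal_right_ideal_eq)
qed

lemma principal_left_ideal_subset_iff:
  assumes a: "a \<in> carrier G" and b: "b \<in> carrier G"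
  shows "principal_left_ideal G a \<subseteq> principal_left_ideal G b \<longleftrightarrow> (\<exists>s \<in> carrier G. a = s \<otimes> b)"
proof
  assume "principal_left_ideal G a \<subseteq> principal_left_ideal G b"
  moreover have "Some a \<in> principal_left_ideal G a"
    using a by (simp add: principal_left_ideal_eq image_iff) (metis one_closed l_one)
  ultimately show "\<exists>s \<in> carrier G. a = s \<otimes> b"
    using principal_left_ideal_eq[OF b] by auto
next
  assume "\<exists>s \<in> carrier G. a = s \<otimes> b"
  then show "principal_left_ideal G a \<subseteq> principal_left_ideal G b"
    using b m_assoc[symmetric] by (auto simp: principal_left_ideal_eq)
qed

lemma principal_ideal_subset_iff:
  assumes a: "a \<in> carrier G" and b: "b \<in> carrier G"
  shows "principal_ideal G a \<subseteq> principal_ideal G b \<longleftrightarrow>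
    (\<exists>s \<in> carrier G. \<exists>t \<in> carrier G. a = s \<otimes> b \<otimes> t)"
proof
  assume "principal_ideal G a \<subseteq> principal_ideal G b"
  moreover have "Some a \<in> principal_ideal G a"
    unfolding principal_ideal_eq[OF a] using a by (intro image_eqI[of _ _ "(\<one>, \<one>)"]) auto
  ultimately have "Some a \<in> principal_ideal G b" by blast
  then show "\<exists>s \<in> carrier G. \<exists>t \<in> carrier G. a = s \<otimes> b \<otimes> t"
    by (auto simp: principal_ideal_eq[OF b])
next
  assume "\<exists>s \<in> carrier G. \<exists>t \<in> carrier G. a = s \<otimes> b \<otimes> t"
  then obtain s t where st: "s \<in> carrier G" "t \<in> carrier G" "a = s \<otimes> b \<otimes> t" by blast
  show "principal_ideal G a \<subseteq> principal_ideal G b"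
  proof
    fix x assume "x \<in> principal_ideal G a"
    then obtain u v where uv: "u \<in> carrier G" "v \<in> carrier G" "x = Some (u \<otimes> a \<otimes> v)"
      using principal_ideal_eq[OF a] by auto
    then have "x = Some ((u \<otimes> s) \<otimes> b \<otimes> (t \<otimes> v))"
      using st b by (simp add: m_assoc)
    then show "x \<in> principal_ideal G b"
      unfolding principal_ideal_eq[OF b]
      using st uv by (intro image_eqI[of _ _ "(u \<otimes> s, t \<otimes> v)"]) auto
  qed
qed

end

section \<open>Maximal chains of finite sets\<close>

text \<open>If no member had size \<open>n\<close>, there would be a largest member \<open>M\<close>
  below that size and possibly a smallest member \<open>N\<close> above it. A set \<open>K\<close>
  of size \<open>n\<close> between them, or containing \<open>M\<close> if there is no
  \<open>N\<close>, is comparable with the whole chain, so maximality puts it into \<open>C\<close>.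
  The order is reversed to match the natural order of idempotents under complementation.\<close>

lemma maxchain_Fpow_card_surj:
  assumes X: "infinite X" and mc: "pred_on.maxchain (Fpow X) (\<lambda>A B. B \<subseteq> A) C"
  shows "\<exists>A \<in> C. card A = n"
proof (rule ccontr)
  assume no: "\<not> (\<exists>A \<in> C. card A = n)"
  have sub: "C \<subseteq> Fpow X" and tot: "\<And>A B. A \<in> C \<Longrightarrow> B \<in> C \<Longrightarrow> A \<subseteq> B \<or> B \<subseteq> A"
    using mc by (auto simp: pred_on.maxchain_def pred_on.chain_def)
  \<comment> \<open>Maximality in usable form: a finite subset comparable with every member is a
    member.\<close>
  have memI: "K \<in> C" if "K \<in> Fpow X" "\<And>A. A \<in> C \<Longrightarrow> A \<subseteq> K \<or> K \<subseteq> A" for K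
  proof (rule ccontr)
    assume "K \<notin> C"
    then have "C \<subset> insert K C" by blast
    moreover have "pred_on.chain (Fpow X) (\<lambda>A B. B \<subseteq> A) (insert K C)"
      using that sub tot unfolding pred_on.chain_def by blast
    ultimately show False
      using mc by (auto simp: pred_on.maxchain_def)
  qed
  have fin: "finite A" if "A \<in> C" for A
    using sub that by (auto simp: Fpow_def)
  have mono: "A \<subseteq> B" if "A \<in> C" "B \<in> C" "card A < card B" for A B
    using that tot[of A B] fin card_mono[of A B] by auto
  have "{} \<in> C"
    by (rule memI) (auto simp: Fpow_def)
  with no have n: "0 < n" by force
  obtain M where M: "M \<in> C" "card M < n" and Mmax: "\<And>A. A \<in> C \<Longrightarrow> card A < n \<Longrightarrow> card A \<le> card M"
    using ex_has_greatest_nat[of "\<lambda>A. A \<in> C \<and> card A < n" "{}" card n] \<open>{} \<in> C\<close> n by auto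
  have below: "A \<subseteq> M" if "A \<in> C" "card A < n" for A
    using tot[OF that(1) M(1)] Mmax[OF that] fin[OF that(1)] fin[OF M(1)] card_seteq by blast
  have "\<exists>K. M \<subseteq> K \<and> K \<in> Fpow X \<and> card K = n \<and> (\<forall>A \<in> C. n < card A \<longrightarrow> K \<subseteq> A)"
  proof (cases "\<exists>A \<in> C. n < card A")
    case True
    then obtain N where N: "N \<in> C" "n < card N"
      and Nmin: "\<And>A. A \<in> C \<Longrightarrow> n < card A \<Longrightarrow> card N \<le> card A"
      using ex_has_least_nat[of "\<lambda>A. A \<in> C \<and> n < card A" _ card] by blast
    have above: "N \<subseteq> A" if "A \<in> C" "n < card A" for A
      using tot[OF that(1) N(1)] Nmin[OF that] fin[OF that(1)] fin[OF N(1)] card_seteq by blast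
    obtain K where "M \<subseteq> K" "K \<subseteq> N" "card K = n"
      using exists_subset_between[of M n N] mono[OF M(1) N(1)] M N fin by auto
    moreover have "K \<in> Fpow X"
      using \<open>K \<subseteq> N\<close> N(1) sub by (auto simp: Fpow_def intro: finite_subset)
    ultimately show ?thesis
      using above by blast
  next
    \<comment> \<open>Nothing lies above, so \<open>M\<close> is enlarged freely by points of the
      infinite set \<open>X\<close>.\<close>
    case False
    have "M \<subseteq> X" "finite M" using M sub by (auto simp: Fpow_def)
    then obtain D where "D \<subseteq> X - M" "finite D" "card D = n - card M"
      using infinite_arbitrarily_large[OF Diff_infinite_finite[OF _ X]] by metis
    moreover from this have "card (M \<union> D) = n"
      using card_Un_disjoint[of M D] \<open>finite M\<close> M by auto
    ultimately show ?thesis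
      using False \<open>M \<subseteq> X\<close> \<open>finite M\<close> by (intro exI[of _ "M \<union> D"]) (auto simp: Fpow_def)
  qed
  then obtain K where K: "M \<subseteq> K" "K \<in> Fpow X" "card K = n" "\<forall>A \<in> C. n < card A \<longrightarrow> K \<subseteq> A"
    by blast
  have "K \<in> C"
  proof (rule memI[OF K(2)])
    fix A assume "A \<in> C"
    moreover from this no have "card A < n \<or> n < card A" by (metis nat_neq_iff)
    ultimately show "A \<subseteq> K \<or> K \<subseteq> A" using below K by blast
  qed
  with no K show False by blast
qed

text \<open>Both omega-chains of the theorem are recognised by a rank that takes each natural number
  exactly once; the sign places rank 0 on top.\<close>

lemma neg_int_bij_betw:
  assumes "inj_on f C" "\<And>n. \<exists>x \<in> C. f x = (n::nat)"
  shows "bij_betw (\<lambda>x. - int (f x)) C {..0}"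
proof -
  have "z \<in> (\<lambda>x. - int (f x)) ` C" if "z \<le> 0" for z
    using assms(2)[of "nat (- z)"] that by (force simp: image_def)
  then show ?thesis
    using assms(1) by (auto simp: bij_betw_def inj_on_def)
qed

section \<open>Almost identical injective partial maps\<close>

text \<open>The two finiteness conditions merge into one: a point of \<open>X\<close> with
  \<open>\<alpha> x \<noteq> Some x\<close> is either missing from the domain or moved.\<close>

lemma almost_identity_carrier_iff:
  "\<alpha> \<in> carrier (almost_identity_semigroup X) \<longleftrightarrow>
     (\<forall>x y. \<alpha> x = Some y \<longrightarrow> x \<in> X \<and> y \<in> X) \<and>
     (\<forall>x y z. \<alpha> x = Some z \<longrightarrow> \<alpha> y = Some z \<longrightarrow> x = y) \<and>
     finite {x \<in> X. \<alpha> x \<noteq> Some x}"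
proof -
  have "{x \<in> X. \<alpha> x \<noteq> Some x} = (X - dom \<alpha>) \<union> {x \<in> dom \<alpha>. \<alpha> x \<noteq> Some x}" if "dom \<alpha> \<subseteq> X"
    using that by auto
  moreover have "inj_on \<alpha> (dom \<alpha>) \<longleftrightarrow> (\<forall>x y z. \<alpha> x = Some z \<longrightarrow> \<alpha> y = Some z \<longrightarrow> x = y)"
    by (intro iffI allI impI inj_onI) (metis domI inj_onD, metis domD)
  moreover have "dom \<alpha> \<subseteq> X \<and> ran \<alpha> \<subseteq> X \<longleftrightarrow> (\<forall>x y. \<alpha> x = Some y \<longrightarrow> x \<in> X \<and> y \<in> X)"
    by (auto simp: ran_def dom_def)
  ultimately show ?thesis
    unfolding almost_identity_semigroup_def sym_inverse_semigroup_def almost_everywhere_identity_def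
    by auto
qed

lemma almost_identity_mult [simp]:
  "\<alpha> \<otimes>\<^bsub>almost_identity_semigroup X\<^esub> \<beta> = \<beta> \<circ>\<^sub>m \<alpha>"
  by (simp add: almost_identity_semigroup_def sym_inverse_semigroup_def)

section \<open>Elements, inverses and the defect\<close>

locale almost_identity =
  fixes X :: "'a set"
begin

abbreviation S :: "('a \<rightharpoonup> 'a) monoid" where "S \<equiv> almost_identity_semigroup X"

text \<open>For elements of \<open>S\<close> the complement of the domain is finite, so the default
  value 0 of \<open>card\<close> on infinite sets never interferes.\<close>

abbreviation defect :: "('a \<rightharpoonup> 'a) \<Rightarrow> nat" where "defect \<alpha> \<equiv> card (X - dom \<alpha>)"

sublocale monoid S
  by (rule monoid_almost_identity_semigroup)

lemma carrierD:
  assumes "\<alpha> \<in> carrier S"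
  shows "\<alpha> x = Some y \<Longrightarrow> x \<in> X" "\<alpha> x = Some y \<Longrightarrow> y \<in> X"
    "\<alpha> x = Some z \<Longrightarrow> \<alpha> y = Some z \<Longrightarrow> x = y"
    "finite {x \<in> X. \<alpha> x \<noteq> Some x}"
    "finite (X - dom \<alpha>)" "dom \<alpha> \<subseteq> X" "ran \<alpha> \<subseteq> X"
proof -
  have *: "(\<forall>x y. \<alpha> x = Some y \<longrightarrow> x \<in> X \<and> y \<in> X)"
    "(\<forall>x y z. \<alpha> x = Some z \<longrightarrow> \<alpha> y = Some z \<longrightarrow> x = y)" "finite {x \<in> X. \<alpha> x \<noteq> Some x}"
    using assms by (simp_all add: almost_identity_carrier_iff)
  then show "\<alpha> x = Some y \<Longrightarrow> x \<in> X" "\<alpha> x = Some y \<Longrightarrow> y \<in> X"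
    "\<alpha> x = Some z \<Longrightarrow> \<alpha> y = Some z \<Longrightarrow> x = y"
    "finite {x \<in> X. \<alpha> x \<noteq> Some x}" "dom \<alpha> \<subseteq> X" "ran \<alpha> \<subseteq> X"
    by (blast, blast, blast, blast, auto simp: ran_def)
  show "finite (X - dom \<alpha>)"
    by (rule finite_subset[OF _ *(3)]) auto
qed

lemma mult_closed: "\<alpha> \<in> carrier S \<Longrightarrow> \<beta> \<in> carrier S \<Longrightarrow> \<beta> \<circ>\<^sub>m \<alpha> \<in> carrier S"
  using m_closed[of \<alpha> \<beta>] by simp

text \<open>The converse relation is a partial function because \<open>\<alpha>\<close> is
  injective, and it fixes the same points as \<open>\<alpha>\<close>, so it is again almost
  everywhere the identity.\<close>

lemma obtain_inverse:
  assumes a: "\<alpha> \<in> carrier S"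
  obtains \<beta> where "\<beta> \<in> carrier S" "\<And>x y. \<beta> y = Some x \<longleftrightarrow> \<alpha> x = Some y"
    "dom \<beta> = ran \<alpha>" "ran \<beta> = dom \<alpha>"
proof -
  note d = carrierD[OF a]
  define \<beta> where "\<beta> y = (if \<exists>x. \<alpha> x = Some y then Some (SOME x. \<alpha> x = Some y) else None)" for y
  have b: "\<beta> y = Some x \<longleftrightarrow> \<alpha> x = Some y" for x y
  proof
    assume "\<beta> y = Some x"
    then show "\<alpha> x = Some y"
      by (auto simp: \<beta>_def split: if_splits intro: someI)
  next
    assume xy: "\<alpha> x = Some y"
    then have "(SOME x. \<alpha> x = Some y) = x"
      by (rule some_equality) (rule d(3)[OF _ xy])
    then show "\<beta> y = Some x"
      using xy by (auto simp: \<beta>_def)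
  qed
  have "{y \<in> X. \<beta> y \<noteq> Some y} \<subseteq> {x \<in> X. \<alpha> x \<noteq> Some x}"
    by (auto simp: b)
  then have "finite {y \<in> X. \<beta> y \<noteq> Some y}"
    using d(4) finite_subset by blast
  then have "\<beta> \<in> carrier S"
    using d(1,2) by (auto simp: almost_identity_carrier_iff b)
  moreover have "dom \<beta> = ran \<alpha>" "ran \<beta> = dom \<alpha>"
    by (auto simp: dom_def ran_def b)
  ultimately show ?thesis
    using b that by blast
qed

text \<open>Outside a finite \<open>F\<close> that contains every moved or missing point and every image of a moved
  point, the map is the identity, so both complements are complements within \<open>F\<close> and can be counted.\<close>

lemma card_compl_ran:
  assumes a: "\<alpha> \<in> carrier S"
  shows "card (X - ran \<alpha>) = defect \<alpha>"
proof -
  note d = carrierD[OF a]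
  let ?M = "{x \<in> X. \<alpha> x \<noteq> Some x}"
  define F where "F = ?M \<union> (the \<circ> \<alpha>) ` (?M \<inter> dom \<alpha>)"
  have F: "finite F"
    using d(4) by (simp add: F_def)
  have FX: "F \<subseteq> X"
    using d(2) by (auto simp: F_def)
  \<comment> \<open>A point of \<open>F\<close> in the range is its own preimage or the image of a
    moved point, so its preimage lies in \<open>F\<close>; likewise the image of a point of
    \<open>F\<close> is that point or the image of a moved one.\<close>
  have "F \<inter> ran \<alpha> = (the \<circ> \<alpha>) ` (F \<inter> dom \<alpha>)"
  proof (intro equalityI subsetI)
    fix y assume y: "y \<in> F \<inter> ran \<alpha>"
    then obtain x where x: "\<alpha> x = Some y" by (auto simp: ran_def)
    have "x \<in> F"
    proof (cases "x = y")
      case True then show ?thesis using y by simp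
    next
      case False then show ?thesis using x d(1)[OF x] by (auto simp: F_def)
    qed
    then show "y \<in> (the \<circ> \<alpha>) ` (F \<inter> dom \<alpha>)"
      using x by (force simp: image_def)
  next
    fix y assume "y \<in> (the \<circ> \<alpha>) ` (F \<inter> dom \<alpha>)"
    then obtain x where x: "\<alpha> x = Some y" "x \<in> F" by auto
    have "y \<in> F"
    proof (cases "x = y")
      case True then show ?thesis using x by simp
    next
      case False
      then have "x \<in> ?M \<inter> dom \<alpha>" using x d(1)[OF x(1)] by auto
      then show ?thesis using x unfolding F_def by force
    qed
    then show "y \<in> F \<inter> ran \<alpha>" using x by (auto simp: ran_def)
  qed
  moreover have "inj_on (the \<circ> \<alpha>) (F \<inter> dom \<alpha>)"
    using d(3) by (auto simp: inj_on_def)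
  ultimately have eq: "card (F \<inter> ran \<alpha>) = card (F \<inter> dom \<alpha>)"
    by (simp only: card_image)
  have "\<alpha> x = Some x" if "x \<in> X - F" for x
    using that by (auto simp: F_def)
  then have "X - ran \<alpha> = F - F \<inter> ran \<alpha>" "X - dom \<alpha> = F - F \<inter> dom \<alpha>"
    using FX by (auto simp: ran_def)
  then show ?thesis
    using eq F by (simp add: card_Diff_subset)
qed

text \<open>The domain of a product lies in that of the left factor and its range in that of the
  right factor; \<open>card_compl_ran\<close> converts the second inclusion into a statement on
  defects.\<close>

lemma mult_defect:
  assumes "\<alpha> \<in> carrier S" "\<beta> \<in> carrier S"
  shows "defect \<alpha> \<le> defect (\<beta> \<circ>\<^sub>m \<alpha>)" "defect \<beta> \<le> defect (\<beta> \<circ>\<^sub>m \<alpha>)"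
proof -
  have c: "\<beta> \<circ>\<^sub>m \<alpha> \<in> carrier S"
    using assms by (rule mult_closed)
  show "defect \<alpha> \<le> defect (\<beta> \<circ>\<^sub>m \<alpha>)"
    by (rule card_mono[OF carrierD(5)[OF c]]) (auto simp: map_comp_Some_iff)
  \<comment> \<open>A range is the domain of the inverse, hence cofinite; \<open>card_mono\<close>
    needs this.\<close>
  have "finite (X - ran (\<beta> \<circ>\<^sub>m \<alpha>))"
  proof -
    obtain \<gamma> where "\<gamma> \<in> carrier S" "dom \<gamma> = ran (\<beta> \<circ>\<^sub>m \<alpha>)"
      using obtain_inverse[OF c] by metis
    then show ?thesis using carrierD(5) by metis
  qed
  then have "card (X - ran \<beta>) \<le> card (X - ran (\<beta> \<circ>\<^sub>m \<alpha>))"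
    by (rule card_mono) (auto simp: map_comp_Some_iff ran_def)
  then show "defect \<beta> \<le> defect (\<beta> \<circ>\<^sub>m \<alpha>)"
    by (simp add: card_compl_ran c assms)
qed

section \<open>Elements with prescribed domain and range, and factorization\<close>

text \<open>All movement can be confined to \<open>A \<union> B\<close>: the map is the identity
  outside it and sends \<open>B - A\<close> bijectively onto \<open>A - B\<close>, two finite sets
  of equal size.\<close>

lemma ex_dom_ran:
  assumes A: "A \<subseteq> X" "finite A" and B: "B \<subseteq> X" "finite B" and eq: "card A = card B"
  obtains \<gamma> where "\<gamma> \<in> carrier S" "dom \<gamma> = X - A" "ran \<gamma> = X - B"
proof -
  let ?F = "A \<union> B"
  have "card (?F - A) = card (?F - B)"
    using A B eq by (simp add: card_Diff_subset)
  then obtain g where g: "bij_betw g (?F - A) (?F - B)"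
    using A B by (meson finite_Diff finite_UnI bij_betw_iff_card)
  define \<gamma> where "\<gamma> x = (if x \<in> X - ?F then Some x else if x \<in> ?F - A then Some (g x) else None)" for x
  have gB: "g x \<in> ?F - B" if "x \<in> ?F - A" for x
    using g that by (rule bij_betw_apply)
  have gi: "x = y" if "x \<in> ?F - A" "y \<in> ?F - A" "g x = g y" for x y
    using g that by (auto simp: bij_betw_def dest: inj_onD)
  have gs: "\<exists>x \<in> ?F - A. y = g x" if "y \<in> ?F - B" for y
    using g that by (auto simp: bij_betw_def)
  have "{x \<in> X. \<gamma> x \<noteq> Some x} \<subseteq> ?F"
    by (auto simp: \<gamma>_def)
  then have "finite {x \<in> X. \<gamma> x \<noteq> Some x}"
    using A B finite_subset by blast
  moreover have "x \<in> X \<and> y \<in> X" if "\<gamma> x = Some y" for x y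
    using that gB[of x] A B by (auto simp: \<gamma>_def split: if_splits)
  moreover have "x = y" if "\<gamma> x = Some z" "\<gamma> y = Some z" for x y z
    using that gB[of x] gB[of y] gi[of x y] by (auto simp: \<gamma>_def split: if_splits)
  ultimately have "\<gamma> \<in> carrier S"
    by (auto simp: almost_identity_carrier_iff)
  moreover have "dom \<gamma> = X - A"
    using A B by (auto simp: \<gamma>_def split: if_splits)
  moreover have "ran \<gamma> = X - B"
  proof (intro equalityI subsetI)
    fix y assume "y \<in> ran \<gamma>"
    then obtain x where "\<gamma> x = Some y" by (auto simp: ran_def)
    then show "y \<in> X - B"
      using gB[of x] A B by (auto simp: \<gamma>_def split: if_splits)
  next
    fix y assume y: "y \<in> X - B"
    show "y \<in> ran \<gamma>"
    proof (cases "y \<in> ?F")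
      case True
      then obtain x where "x \<in> ?F - A" "y = g x" using gs[of y] y by blast
      then have "\<gamma> x = Some y" by (auto simp: \<gamma>_def)
      then show ?thesis by (auto simp: ran_def)
    next
      case False
      then have "\<gamma> y = Some y" using y by (auto simp: \<gamma>_def)
      then show ?thesis by (auto simp: ran_def)
    qed
  qed
  ultimately show ?thesis using that by blast
qed

text \<open>With \<open>\<gamma>\<close> mapping a cofinite \<open>X - A \<supseteq> dom \<alpha>\<close> onto \<open>dom \<beta>\<close>, the product of \<open>\<gamma>\<close>, \<open>\<beta>\<close> and the
  inverse of \<open>\<gamma>\<beta>\<close> is the identity of \<open>X - A\<close>, whence \<open>\<alpha> = \<gamma>\<beta>((\<gamma>\<beta>)\<^sup>-\<^sup>1\<alpha>)\<close>.\<close>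

lemma factorization:
  assumes a: "\<alpha> \<in> carrier S" and b: "\<beta> \<in> carrier S" and le: "defect \<beta> \<le> defect \<alpha>"
  obtains \<gamma> \<delta> where "\<gamma> \<in> carrier S" "\<delta> \<in> carrier S" "\<alpha> = \<gamma> \<otimes>\<^bsub>S\<^esub> \<beta> \<otimes>\<^bsub>S\<^esub> \<delta>"
    "defect \<gamma> = defect \<beta>" "defect \<delta> = defect \<alpha>"
proof -
  note da = carrierD[OF a] and db = carrierD[OF b]
  \<comment> \<open>The map \<open>\<gamma>\<close> must be defined wherever \<open>\<alpha>\<close>
    is, so \<open>A\<close> is chosen among the points that \<open>\<alpha>\<close> misses;
    \<open>le\<close> says that there are enough of them.\<close>
  obtain A where A: "A \<subseteq> X - dom \<alpha>" "card A = defect \<beta>" "finite A"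
    using obtain_subset_with_card_n[OF le] .
  then have AX: "A \<subseteq> X" by blast
  obtain \<gamma> where g: "\<gamma> \<in> carrier S" "dom \<gamma> = X - A" "ran \<gamma> = X - (X - dom \<beta>)"
    using ex_dom_ran[OF AX A(3) Diff_subset db(5) A(2)] .
  then have rg: "ran \<gamma> = dom \<beta>" using db(6) by blast
  have gb: "\<beta> \<circ>\<^sub>m \<gamma> \<in> carrier S"
    using mult_closed g(1) b .
  obtain \<eta> where e: "\<eta> \<in> carrier S" "\<And>x y. \<eta> y = Some x \<longleftrightarrow> (\<beta> \<circ>\<^sub>m \<gamma>) x = Some y"
    using obtain_inverse[OF gb] by metis
  let ?\<delta> = "\<alpha> \<circ>\<^sub>m \<eta>"
  have d: "?\<delta> \<in> carrier S"
    using mult_closed e(1) a .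
  have eq: "\<alpha> = ?\<delta> \<circ>\<^sub>m (\<beta> \<circ>\<^sub>m \<gamma>)"
  proof
    fix x
    show "\<alpha> x = (?\<delta> \<circ>\<^sub>m (\<beta> \<circ>\<^sub>m \<gamma>)) x"
    proof (cases "x \<in> X - A")
      case True
      then have "x \<in> dom \<gamma>" using g(2) by simp
      then obtain u where u: "\<gamma> x = Some u" by blast
      then have "u \<in> dom \<beta>" using rg by (auto simp: ran_def)
      then obtain v where v: "\<beta> u = Some v" by auto
      have bg: "(\<beta> \<circ>\<^sub>m \<gamma>) x = Some v" using u v by simp
      then have "\<eta> v = Some x" using e(2) by blast
      then show ?thesis using bg by (simp add: map_comp_simps(2))
    next
      case False
      then have "\<alpha> x = None" using A da(6) by auto
      moreover have "\<gamma> x = None" using False g(2) by (metis domIff)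
      ultimately show ?thesis by simp
    qed
  qed
  have "dom ?\<delta> = (\<lambda>x. the ((\<beta> \<circ>\<^sub>m \<gamma>) x)) ` dom \<alpha>" (is "_ = ?T")
  proof (intro equalityI subsetI)
    fix y assume "y \<in> dom ?\<delta>"
    then obtain z where "?\<delta> y = Some z" by blast
    then obtain x where x: "\<eta> y = Some x" "\<alpha> x = Some z" by (auto simp: map_comp_Some_iff)
    then have "(\<beta> \<circ>\<^sub>m \<gamma>) x = Some y" using e(2) by blast
    then show "y \<in> ?T" using x(2) by (intro image_eqI[of _ _ x]) auto
  next
    fix y assume "y \<in> ?T"
    then obtain x where x: "x \<in> dom \<alpha>" "y = the ((\<beta> \<circ>\<^sub>m \<gamma>) x)" by blast
    have "x \<in> dom (\<beta> \<circ>\<^sub>m \<gamma>)" using x(1) eq by (metis domD domI map_comp_Some_iff)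
    then have "\<eta> y = Some x" using x e(2) by auto
    then show "y \<in> dom ?\<delta>" using x by auto
  qed
  \<comment> \<open>The defect of \<open>?\<delta>\<close> is counted on the side of the range,
    where it visibly agrees with that of \<open>\<alpha>\<close>.\<close>
  have "ran ?\<delta> = ran \<alpha>"
  proof
    show "ran ?\<delta> \<subseteq> ran \<alpha>" by (auto simp: ran_def map_comp_Some_iff)
    show "ran \<alpha> \<subseteq> ran ?\<delta>" by (subst (1) eq) (auto simp: ran_def map_comp_Some_iff)
  qed
  then have "defect ?\<delta> = defect \<alpha>"
    using card_compl_ran[OF d] card_compl_ran[OF a] by simp
  moreover have "defect \<gamma> = defect \<beta>"
    using A g(2) by (simp add: double_diff Diff_Diff_Int inf_absorb2 subset_iff)
  ultimately show ?thesis
    using that[OF g(1) d] eq by simp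
qed

section \<open>Idempotents and their maximal chains\<close>

text \<open>If an idempotent sends \<open>x\<close> to \<open>y\<close>, it also sends
  \<open>y\<close> to \<open>y\<close>, and injectivity forces \<open>x = y\<close>.\<close>

lemma idempotents_iff:
  assumes a: "\<alpha> \<in> carrier S"
  shows "\<alpha> \<in> idempotents S \<longleftrightarrow> (\<forall>x \<in> dom \<alpha>. \<alpha> x = Some x)"
proof
  assume "\<alpha> \<in> idempotents S"
  then have e: "\<alpha> \<circ>\<^sub>m \<alpha> = \<alpha>" by (simp add: idempotents_def)
  show "\<forall>x \<in> dom \<alpha>. \<alpha> x = Some x"
  proof
    fix x assume "x \<in> dom \<alpha>"
    then obtain y where y: "\<alpha> x = Some y" by blast
    then have "\<alpha> y = Some y" using fun_cong[OF e, of x] by simp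
    then show "\<alpha> x = Some x" using carrierD(3)[OF a y] y by simp
  qed
next
  assume *: "\<forall>x \<in> dom \<alpha>. \<alpha> x = Some x"
  have "(\<alpha> \<circ>\<^sub>m \<alpha>) x = \<alpha> x" for x
    using * by (cases "x \<in> dom \<alpha>") (simp_all add: map_comp_def domIff)
  then have "\<alpha> \<circ>\<^sub>m \<alpha> = \<alpha>" by (rule ext)
  then show "\<alpha> \<in> idempotents S" using a by (simp add: idempotents_def)
qed

lemma restrict_Some_idempotent:
  assumes "A \<in> Fpow X"
  shows "Some |` (X - A) \<in> idempotents S"
proof -
  have "{x \<in> X. (Some |` (X - A)) x \<noteq> Some x} \<subseteq> A"
    by (auto simp: restrict_map_def)
  then have "finite {x \<in> X. (Some |` (X - A)) x \<noteq> Some x}"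
    using assms finite_subset by (auto simp: Fpow_def)
  then have "Some |` (X - A) \<in> carrier S"
    by (auto simp: almost_identity_carrier_iff restrict_map_def split: if_splits)
  then show ?thesis
    by (auto simp: idempotents_iff restrict_map_def split: if_splits)
qed

lemma idempotentD:
  assumes "\<epsilon> \<in> idempotents S"
  shows "\<epsilon> = Some |` dom \<epsilon>" "\<epsilon> \<in> carrier S" "X - dom \<epsilon> \<in> Fpow X"
proof -
  show c: "\<epsilon> \<in> carrier S" using assms by (simp add: idempotents_def)
  show "X - dom \<epsilon> \<in> Fpow X" using carrierD(5)[OF c] by (auto simp: Fpow_def)
  have *: "\<forall>x \<in> dom \<epsilon>. \<epsilon> x = Some x" using assms c idempotents_iff by blast
  have "\<epsilon> x = (Some |` dom \<epsilon>) x" for x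
    using * by (cases "x \<in> dom \<epsilon>") (simp_all add: domIff)
  then show "\<epsilon> = Some |` dom \<epsilon>" by (rule ext)
qed

lemma restrict_Some_comp: "Some |` B \<circ>\<^sub>m Some |` A = Some |` (A \<inter> B)"
  by (auto simp: fun_eq_iff map_comp_def restrict_map_def)

text \<open>Idempotents are partial identities, so multiplying them intersects domains. The natural
  order and the isomorphism with finite subsets are both read off from this.\<close>

lemma mult_idempotents_eq:
  assumes "\<epsilon> \<in> idempotents S" "\<iota> \<in> idempotents S"
  shows "\<iota> \<circ>\<^sub>m \<epsilon> = Some |` (dom \<epsilon> \<inter> dom \<iota>)"
  using restrict_Some_comp idempotentD(1)[OF assms(1)] idempotentD(1)[OF assms(2)] by metis

lemma natural_le_iff:
  assumes e: "\<epsilon> \<in> idempotents S" and i: "\<iota> \<in> idempotents S"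
  shows "natural_le S \<epsilon> \<iota> \<longleftrightarrow> dom \<epsilon> \<subseteq> dom \<iota>"
proof -
  have "natural_le S \<epsilon> \<iota> \<longleftrightarrow> Some |` (dom \<epsilon> \<inter> dom \<iota>) = \<epsilon>"
    using mult_idempotents_eq[OF e i] mult_idempotents_eq[OF i e]
    by (auto simp: natural_le_def Int_commute)
  also have "\<dots> \<longleftrightarrow> dom \<epsilon> \<inter> dom \<iota> = dom \<epsilon>"
  proof
    assume "Some |` (dom \<epsilon> \<inter> dom \<iota>) = \<epsilon>"
    then have "dom (Some |` (dom \<epsilon> \<inter> dom \<iota>)) = dom \<epsilon>" by simp
    then show "dom \<epsilon> \<inter> dom \<iota> = dom \<epsilon>" by auto
  next
    assume "dom \<epsilon> \<inter> dom \<iota> = dom \<epsilon>"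
    then show "Some |` (dom \<epsilon> \<inter> dom \<iota>) = \<epsilon>" using idempotentD(1)[OF e] by simp
  qed
  finally show ?thesis by blast
qed

lemma bij_betw_idempotents: "bij_betw (\<lambda>\<epsilon>. X - dom \<epsilon>) (idempotents S) (Fpow X)"
proof (rule bij_betwI[where g = "\<lambda>A. Some |` (X - A)"])
  show "(\<lambda>\<epsilon>. X - dom \<epsilon>) \<in> idempotents S \<rightarrow> Fpow X"
    using idempotentD by blast
  show "(\<lambda>A. Some |` (X - A)) \<in> Fpow X \<rightarrow> idempotents S"
    using restrict_Some_idempotent by blast
  show "Some |` (X - (X - dom \<epsilon>)) = \<epsilon>" if "\<epsilon> \<in> idempotents S" for \<epsilon>
    using idempotentD(1)[OF that] carrierD(6)[OF idempotentD(2)[OF that]]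
    by (simp add: double_diff)
  show "X - dom (Some |` (X - A)) = A" if "A \<in> Fpow X" for A
    using that by (auto simp: Fpow_def)
qed

lemma idempotent_semilattice_iso:
  "(\<lambda>\<epsilon>. X - dom \<epsilon>) \<in> iso (idempotent_semilattice S) (finite_subsets_semilattice X)"
proof -
  have "X - dom (\<iota> \<circ>\<^sub>m \<epsilon>) = (X - dom \<epsilon>) \<union> (X - dom \<iota>)"
    if "\<epsilon> \<in> idempotents S" "\<iota> \<in> idempotents S" for \<epsilon> \<iota>
    by (simp add: mult_idempotents_eq[OF that] Diff_Int)
  then show ?thesis
    using bij_betw_idempotents idempotentD(3)
    by (auto simp: iso_def hom_def idempotent_semilattice_def finite_subsets_semilattice_def)
qed

text \<open>Complementation \<open>h\<close> carries \<open>C\<close> to a maximal chain of finite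
  subsets, where every size occurs. Within a chain of finite sets inclusion is comparison of sizes,
  so the negated defect is an order isomorphism.\<close>

lemma maxchain_omega_chain:
  assumes X: "infinite X" and mc: "pred_on.maxchain (idempotents S) (natural_le S) C"
  shows "is_omega_chain C (natural_le S)"
proof -
  define h where "h \<epsilon> = X - dom \<epsilon>" for \<epsilon> :: "'a \<rightharpoonup> 'a"
  have CE: "C \<subseteq> idempotents S"
    \<comment> \<open>The third alternative is there because \<open>pred_on.chain\<close> compares
      by the reflexive closure of the relation.\<close>
    and tot: "\<And>\<epsilon> \<iota>. \<epsilon> \<in> C \<Longrightarrow> \<iota> \<in> C \<Longrightarrow> natural_le S \<epsilon> \<iota> \<or> natural_le S \<iota> \<epsilon> \<or> \<epsilon> = \<iota>"
    using mc by (auto simp: pred_on.maxchain_def pred_on.chain_def)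
  have le: "natural_le S \<epsilon> \<iota> \<longleftrightarrow> h \<iota> \<subseteq> h \<epsilon>" if "\<epsilon> \<in> idempotents S" "\<iota> \<in> idempotents S" for \<epsilon> \<iota>
    using natural_le_iff[OF that] carrierD(6)[OF idempotentD(2)[OF that(1)]]
    unfolding h_def by blast
  have bij: "bij_betw h (idempotents S) (Fpow X)"
    unfolding h_def[abs_def] by (rule bij_betw_idempotents)
  have "pred_on.maxchain (Fpow X) (\<lambda>A B. B \<subseteq> A) (h ` C)"
    unfolding pred_on.maxchain_def
  proof (intro conjI notI)
    have "h \<epsilon> \<subseteq> h \<iota> \<or> h \<iota> \<subseteq> h \<epsilon>" if "\<epsilon> \<in> C" "\<iota> \<in> C" for \<epsilon> \<iota>
      using tot[OF that] that CE le by (metis subset_eq)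
    moreover have "h ` C \<subseteq> Fpow X"
      using bij CE by (auto simp: bij_betw_def)
    ultimately show "pred_on.chain (Fpow X) (\<lambda>A B. B \<subseteq> A) (h ` C)"
      unfolding pred_on.chain_def by blast
    assume "\<exists>T. pred_on.chain (Fpow X) (\<lambda>A B. B \<subseteq> A) T \<and> h ` C \<subset> T"
    then obtain T where T: "pred_on.chain (Fpow X) (\<lambda>A B. B \<subseteq> A) T" "h ` C \<subset> T" by blast
    \<comment> \<open>A larger chain of sets pulls back along \<open>h\<close> to a chain of
      idempotents properly containing \<open>C\<close>, against maximality.\<close>
    let ?D = "{\<epsilon> \<in> idempotents S. h \<epsilon> \<in> T}"
    have "A \<subseteq> B \<or> B \<subseteq> A" if "A \<in> T" "B \<in> T" for A B
      using T(1) that unfolding pred_on.chain_def by blast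
    then have "natural_le S \<epsilon> \<iota> \<or> natural_le S \<iota> \<epsilon>" if "\<epsilon> \<in> ?D" "\<iota> \<in> ?D" for \<epsilon> \<iota>
      using that le by simp
    then have "pred_on.chain (idempotents S) (natural_le S) ?D"
      unfolding pred_on.chain_def by blast
    moreover have "C \<subset> ?D"
    proof
      show "C \<subseteq> ?D" using CE T(2) by auto
      obtain A where A: "A \<in> T" "A \<notin> h ` C" using T(2) by blast
      then have "A \<in> Fpow X" using T(1) by (auto simp: pred_on.chain_def)
      then obtain \<epsilon> where "\<epsilon> \<in> idempotents S" "A = h \<epsilon>"
        using bij by (auto simp: bij_betw_def)
      then show "C \<noteq> ?D" using A by blast
    qed
    ultimately show False
      using mc by (auto simp: pred_on.maxchain_def)
  qed
  then have surj: "\<exists>\<epsilon> \<in> C. defect \<epsilon> = n" for n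
    using maxchain_Fpow_card_surj[OF X, of "h ` C" n] by (auto simp: h_def)
  have key: "natural_le S \<epsilon> \<iota> \<longleftrightarrow> defect \<iota> \<le> defect \<epsilon>" if "\<epsilon> \<in> C" "\<iota> \<in> C" for \<epsilon> \<iota>
  proof -
    have E: "\<epsilon> \<in> idempotents S" "\<iota> \<in> idempotents S" using that CE by auto
    have fin: "finite (h \<epsilon>)" "finite (h \<iota>)" using E idempotentD(2) carrierD(5) by (auto simp: h_def)
    have "h \<epsilon> \<subseteq> h \<iota> \<or> h \<iota> \<subseteq> h \<epsilon>" using tot[OF that] le E by blast
    then have "h \<iota> \<subseteq> h \<epsilon> \<longleftrightarrow> card (h \<iota>) \<le> card (h \<epsilon>)"
      using card_mono[OF fin(1), of "h \<iota>"] card_seteq[OF fin(2), of "h \<epsilon>"] by auto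
    then show ?thesis
      using le[OF E] by (simp add: h_def)
  qed
  have "inj_on defect C"
  proof (rule inj_onI)
    fix \<epsilon> \<iota> assume c: "\<epsilon> \<in> C" "\<iota> \<in> C" and eq: "defect \<epsilon> = defect \<iota>"
    then have "natural_le S \<epsilon> \<iota>" "natural_le S \<iota> \<epsilon>" using key by auto
    then show "\<epsilon> = \<iota>" by (simp add: natural_le_def)
  qed
  then show ?thesis
    unfolding is_omega_chain_def using neg_int_bij_betw[OF _ surj] key
    by (intro exI[of _ "\<lambda>\<epsilon>. - int (defect \<epsilon>)"]) auto
qed

section \<open>Divisibility and Green's relations\<close>

text \<open>With \<open>\<eta>\<close> the inverse of \<open>\<beta>\<close>, the product of
  \<open>\<beta>\<close> and \<open>\<eta>\<close> is the identity on the domain of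
  \<open>\<beta>\<close>, so multiplying it by \<open>\<alpha>\<close> loses nothing.\<close>

lemma dom_subset_imp_right_multiple:
  assumes a: "\<alpha> \<in> carrier S" and b: "\<beta> \<in> carrier S" and sub: "dom \<alpha> \<subseteq> dom \<beta>"
  shows "\<exists>\<gamma> \<in> carrier S. \<alpha> = \<beta> \<otimes>\<^bsub>S\<^esub> \<gamma>"
proof -
  obtain \<eta> where e: "\<eta> \<in> carrier S" "\<And>x y. \<eta> y = Some x \<longleftrightarrow> \<beta> x = Some y"
    using obtain_inverse[OF b] by metis
  have "\<alpha> x = (\<beta> \<otimes>\<^bsub>S\<^esub> (\<alpha> \<circ>\<^sub>m \<eta>)) x" for x
  proof (cases "\<beta> x")
    case None
    then have "\<alpha> x = None" using sub by (metis domIff subsetD)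
    then show ?thesis using None by simp
  next
    case (Some y)
    then have "\<eta> y = Some x" using e(2) by blast
    then show ?thesis using Some by simp
  qed
  then show ?thesis
    by (intro bexI[OF ext mult_closed[OF e(1) a]])
qed

text \<open>Dually, the product of \<open>\<eta>\<close> and \<open>\<beta>\<close> is the identity
  on the range of \<open>\<beta>\<close>, which contains all values of
  \<open>\<alpha>\<close>.\<close>

lemma ran_subset_imp_left_multiple:
  assumes a: "\<alpha> \<in> carrier S" and b: "\<beta> \<in> carrier S" and sub: "ran \<alpha> \<subseteq> ran \<beta>"
  shows "\<exists>\<gamma> \<in> carrier S. \<alpha> = \<gamma> \<otimes>\<^bsub>S\<^esub> \<beta>"
proof -
  obtain \<eta> where e: "\<eta> \<in> carrier S" "\<And>x y. \<eta> y = Some x \<longleftrightarrow> \<beta> x = Some y"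
    using obtain_inverse[OF b] by metis
  have "\<alpha> x = ((\<eta> \<circ>\<^sub>m \<alpha>) \<otimes>\<^bsub>S\<^esub> \<beta>) x" for x
  proof (cases "\<alpha> x")
    case (Some y)
    then have "y \<in> ran \<beta>" using sub by (auto simp: ran_def)
    then obtain z where "\<beta> z = Some y" by (auto simp: ran_def)
    moreover from this have "\<eta> y = Some z" using e(2) by blast
    ultimately show ?thesis using Some by simp
  qed simp
  then show ?thesis
    by (intro bexI[OF ext mult_closed[OF a e(1)]])
qed

lemma principal_right_ideal_subset_iff_dom:
  assumes a: "\<alpha> \<in> carrier S" and b: "\<beta> \<in> carrier S"
  shows "principal_right_ideal S \<alpha> \<subseteq> principal_right_ideal S \<beta> \<longleftrightarrow> dom \<alpha> \<subseteq> dom \<beta>"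
  unfolding principal_right_ideal_subset_iff[OF a b]
  using dom_subset_imp_right_multiple[OF a b] by (auto simp: map_comp_Some_iff)

lemma principal_left_ideal_subset_iff_ran:
  assumes a: "\<alpha> \<in> carrier S" and b: "\<beta> \<in> carrier S"
  shows "principal_left_ideal S \<alpha> \<subseteq> principal_left_ideal S \<beta> \<longleftrightarrow> ran \<alpha> \<subseteq> ran \<beta>"
  unfolding principal_left_ideal_subset_iff[OF a b]
  using ran_subset_imp_left_multiple[OF a b] by (auto simp: map_comp_Some_iff ran_def)

text \<open>Multiplying on either side cannot lower the defect, and \<open>factorization\<close>
  supplies the multipliers in the other direction.\<close>

lemma principal_ideal_subset_iff_defect:
  assumes a: "\<alpha> \<in> carrier S" and b: "\<beta> \<in> carrier S"
  shows "principal_ideal S \<alpha> \<subseteq> principal_ideal S \<beta> \<longleftrightarrow> defect \<beta> \<le> defect \<alpha>"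
  unfolding principal_ideal_subset_iff[OF a b]
proof
  assume "\<exists>s \<in> carrier S. \<exists>t \<in> carrier S. \<alpha> = s \<otimes>\<^bsub>S\<^esub> \<beta> \<otimes>\<^bsub>S\<^esub> t"
  then obtain s t where st: "s \<in> carrier S" "t \<in> carrier S" "\<alpha> = t \<circ>\<^sub>m (\<beta> \<circ>\<^sub>m s)" by auto
  show "defect \<beta> \<le> defect \<alpha>"
    using mult_defect(2)[OF st(1) b] mult_defect(1)[OF mult_closed[OF st(1) b] st(2)] st(3) by simp
next
  assume "defect \<beta> \<le> defect \<alpha>"
  then show "\<exists>s \<in> carrier S. \<exists>t \<in> carrier S. \<alpha> = s \<otimes>\<^bsub>S\<^esub> \<beta> \<otimes>\<^bsub>S\<^esub> t"
    using factorization[OF a b] by metis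
qed

lemma green_R_iff:
  assumes "\<alpha> \<in> carrier S" "\<beta> \<in> carrier S"
  shows "(\<alpha>, \<beta>) \<in> green_R S \<longleftrightarrow> dom \<alpha> = dom \<beta>"
  using assms principal_right_ideal_subset_iff_dom[of \<alpha> \<beta>] principal_right_ideal_subset_iff_dom[of \<beta> \<alpha>]
  by (auto simp: green_R_def set_eq_subset)

lemma green_L_iff:
  assumes "\<alpha> \<in> carrier S" "\<beta> \<in> carrier S"
  shows "(\<alpha>, \<beta>) \<in> green_L S \<longleftrightarrow> ran \<alpha> = ran \<beta>"
  using assms principal_left_ideal_subset_iff_ran[of \<alpha> \<beta>] principal_left_ideal_subset_iff_ran[of \<beta> \<alpha>]
  by (auto simp: green_L_def set_eq_subset)

lemma green_J_iff:
  assumes "\<alpha> \<in> carrier S" "\<beta> \<in> carrier S"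
  shows "(\<alpha>, \<beta>) \<in> green_J S \<longleftrightarrow> defect \<alpha> = defect \<beta>"
  using assms principal_ideal_subset_iff_defect[of \<alpha> \<beta>] principal_ideal_subset_iff_defect[of \<beta> \<alpha>]
  by (auto simp: green_J_def)

text \<open>An intermediate element shares its range with \<open>\<alpha>\<close> and its domain
  with \<open>\<beta>\<close>. Since domain and range of any element miss equally many points, it
  forces equal defects; conversely \<open>ex_dom_ran\<close> builds it.\<close>

lemma green_D_iff:
  assumes a: "\<alpha> \<in> carrier S" and b: "\<beta> \<in> carrier S"
  shows "(\<alpha>, \<beta>) \<in> green_D S \<longleftrightarrow> defect \<alpha> = defect \<beta>"
proof
  assume "(\<alpha>, \<beta>) \<in> green_D S"
  then obtain \<gamma> where g: "(\<alpha>, \<gamma>) \<in> green_L S" "(\<gamma>, \<beta>) \<in> green_R S"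
    by (auto simp: green_D_def)
  then have c: "\<gamma> \<in> carrier S" by (auto simp: green_L_def)
  have "ran \<alpha> = ran \<gamma>" "dom \<gamma> = dom \<beta>"
    using g green_L_iff[OF a c] green_R_iff[OF c b] by auto
  then show "defect \<alpha> = defect \<beta>"
    using card_compl_ran[OF a] card_compl_ran[OF c] by simp
next
  assume eq: "defect \<alpha> = defect \<beta>"
  \<comment> \<open>The inverse shows that \<open>ran \<alpha>\<close>, being a domain, is
    cofinite.\<close>
  obtain \<eta> where e: "\<eta> \<in> carrier S" "dom \<eta> = ran \<alpha>" using obtain_inverse[OF a] by metis
  have fin: "finite (X - ran \<alpha>)" using carrierD(5)[OF e(1)] e(2) by simp
  have eq': "defect \<beta> = card (X - ran \<alpha>)" using eq card_compl_ran[OF a] by simp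
  obtain \<gamma> where g: "\<gamma> \<in> carrier S" "dom \<gamma> = X - (X - dom \<beta>)" "ran \<gamma> = X - (X - ran \<alpha>)"
    using ex_dom_ran[OF Diff_subset carrierD(5)[OF b] Diff_subset fin eq'] .
  then have "dom \<gamma> = dom \<beta>" "ran \<alpha> = ran \<gamma>"
    using carrierD(6)[OF b] carrierD(7)[OF a] by blast+
  then have "(\<alpha>, \<gamma>) \<in> green_L S" "(\<gamma>, \<beta>) \<in> green_R S"
    using green_L_iff[OF a g(1)] green_R_iff[OF g(1) b] by auto
  then show "(\<alpha>, \<beta>) \<in> green_D S" by (auto simp: green_D_def)
qed

lemma green_D_eq_green_J: "green_D S = green_J S"
proof -
  have "green_D S \<subseteq> carrier S \<times> carrier S"
    by (auto simp: green_D_def green_L_def green_R_def)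
  moreover have "green_J S \<subseteq> carrier S \<times> carrier S"
    by (auto simp: green_J_def)
  ultimately show ?thesis
    using green_D_iff green_J_iff by blast
qed

section \<open>Ideals and the order of the J-classes\<close>

text \<open>Because \<open>X\<close> is infinite, every natural number is a defect; this makes all
  the ideals in question non-empty and lets the chain of J-classes reach every level.\<close>

lemma ex_defect:
  assumes "infinite X"
  obtains \<alpha> where "\<alpha> \<in> carrier S" "defect \<alpha> = n"
proof -
  obtain A where A: "A \<subseteq> X" "finite A" "card A = n"
    using infinite_arbitrarily_large[OF assms] by blast
  obtain \<gamma> where "\<gamma> \<in> carrier S" "dom \<gamma> = X - A" "ran \<gamma> = X - A"
    using ex_dom_ran[OF A(1,2) A(1,2) refl] .
  moreover have "X - (X - A) = A" using A by blast
  ultimately show ?thesis using A that by simp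
qed

lemma semigroup_ideal_defect:
  assumes "infinite X"
  shows "semigroup_ideal S {\<alpha> \<in> carrier S. n \<le> defect \<alpha>}"
proof -
  obtain \<alpha> where "\<alpha> \<in> carrier S" "defect \<alpha> = n"
    using ex_defect[OF assms] .
  moreover have "n \<le> defect (\<beta> \<circ>\<^sub>m \<alpha>)"
    if "\<alpha> \<in> carrier S" "\<beta> \<in> carrier S" "n \<le> defect \<alpha> \<or> n \<le> defect \<beta>" for \<alpha> \<beta>
    using mult_defect[OF that(1,2)] that(3) by linarith
  ultimately show ?thesis
    unfolding semigroup_ideal_def using mult_closed by auto
qed

text \<open>A member \<open>\<beta>\<close> of least defect generates the ideal: by
  \<open>factorization\<close> every element of at least that defect is a two-sided multiple of
  \<open>\<beta>\<close>.\<close>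

lemma semigroup_ideal_eq_defect:
  assumes I: "semigroup_ideal S A"
  shows "\<exists>n. A = {\<alpha> \<in> carrier S. n \<le> defect \<alpha>}"
proof -
  have A: "A \<noteq> {}" "A \<subseteq> carrier S"
    and ideal: "\<And>a s. a \<in> A \<Longrightarrow> s \<in> carrier S \<Longrightarrow> s \<otimes>\<^bsub>S\<^esub> a \<in> A \<and> a \<otimes>\<^bsub>S\<^esub> s \<in> A"
    using I by (auto simp: semigroup_ideal_def)
  obtain \<beta> where b: "\<beta> \<in> A" and min: "\<And>\<alpha>. \<alpha> \<in> A \<Longrightarrow> defect \<beta> \<le> defect \<alpha>"
    using A(1) ex_has_least_nat[of "\<lambda>\<alpha>. \<alpha> \<in> A" _ defect] by blast
  have "\<alpha> \<in> A" if a: "\<alpha> \<in> carrier S" and le: "defect \<beta> \<le> defect \<alpha>" for \<alpha>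
  proof -
    obtain \<gamma> \<delta> where gd: "\<gamma> \<in> carrier S" "\<delta> \<in> carrier S" "\<alpha> = \<gamma> \<otimes>\<^bsub>S\<^esub> \<beta> \<otimes>\<^bsub>S\<^esub> \<delta>"
      using factorization[OF a _ le] A(2) b by (metis subsetD)
    then show ?thesis using ideal b by metis
  qed
  then show ?thesis using A(2) min by (intro exI[of _ "defect \<beta>"]) auto
qed

lemma J_classes_omega_chain:
  assumes X: "infinite X"
  shows "is_omega_chain (carrier S // green_J S) (J_class_le S)"
proof -
  \<comment> \<open>The choice of representative is harmless, since the defect is constant on a
    J-class.\<close>
  define f where "f A = defect (SOME \<alpha>. \<alpha> \<in> A)" for A
  have class_eq: "green_J S `` {\<alpha>} = {\<beta> \<in> carrier S. defect \<beta> = defect \<alpha>}" if "\<alpha> \<in> carrier S" for \<alpha>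
  proof -
    have "green_J S `` {\<alpha>} \<subseteq> carrier S" by (auto simp: green_J_def)
    then show ?thesis using green_J_iff[OF that] by auto
  qed
  have f: "f (green_J S `` {\<alpha>}) = defect \<alpha>" if "\<alpha> \<in> carrier S" for \<alpha>
    unfolding f_def class_eq[OF that] by (rule someI2[of _ \<alpha>]) (use that in auto)
  have "inj_on f (carrier S // green_J S)"
  proof (rule inj_onI)
    fix A B assume A: "A \<in> carrier S // green_J S" and B: "B \<in> carrier S // green_J S" and "f A = f B"
    obtain \<alpha> where a: "\<alpha> \<in> carrier S" "A = green_J S `` {\<alpha>}" using A by (rule quotientE)
    obtain \<beta> where b: "\<beta> \<in> carrier S" "B = green_J S `` {\<beta>}" using B by (rule quotientE)
    have "defect \<alpha> = defect \<beta>" using \<open>f A = f B\<close> unfolding a(2) b(2) f[OF a(1)] f[OF b(1)] .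
    then show "A = B" unfolding a(2) b(2) class_eq[OF a(1)] class_eq[OF b(1)] by simp
  qed
  moreover have "\<exists>A \<in> carrier S // green_J S. f A = n" for n
  proof -
    obtain \<alpha> where "\<alpha> \<in> carrier S" "defect \<alpha> = n" using ex_defect[OF X] .
    then show ?thesis using f by (intro bexI[OF _ quotientI]) auto
  qed
  ultimately have "bij_betw (\<lambda>A. - int (f A)) (carrier S // green_J S) {..0}"
    by (rule neg_int_bij_betw)
  moreover have "J_class_le S A B \<longleftrightarrow> - int (f A) \<le> - int (f B)"
    if A: "A \<in> carrier S // green_J S" and B: "B \<in> carrier S // green_J S" for A B
  proof -
    obtain \<alpha> where a: "\<alpha> \<in> carrier S" "A = green_J S `` {\<alpha>}" using A by (rule quotientE)
    obtain \<beta> where b: "\<beta> \<in> carrier S" "B = green_J S `` {\<beta>}" using B by (rule quotientE)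
    note ab = a(1) b(1) a(2) b(2)
    have "J_class_le S A B \<longleftrightarrow> f B \<le> f A"
    proof
      \<comment> \<open>The representatives behind \<open>J_class_le\<close> may differ from
        \<open>\<alpha>\<close> and \<open>\<beta>\<close>, but \<open>f\<close> recovers the defect
        from the class alone.\<close>
      assume "J_class_le S A B"
      then show "f B \<le> f A"
        by (auto simp: J_class_le_def f principal_ideal_subset_iff_defect)
    next
      assume "f B \<le> f A"
      then have "principal_ideal S \<alpha> \<subseteq> principal_ideal S \<beta>"
        using ab f principal_ideal_subset_iff_defect by simp
      then show "J_class_le S A B"
        using ab by (auto simp: J_class_le_def)
    qed
    then show ?thesis by simp
  qed
  ultimately show ?thesis
    unfolding is_omega_chain_def by blast
qed

end

section \<open>Embeddings\<close>

text \<open>Off the copy of \<open>X\<close> inside \<open>Y\<close> the extension is the identity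
  rather than undefined: that remainder may be infinite, and only finitely many points of
  \<open>Y\<close> may be missing.\<close>

definition extend_along :: "('a \<Rightarrow> 'b) \<Rightarrow> 'a set \<Rightarrow> 'b set \<Rightarrow> ('a \<rightharpoonup> 'a) \<Rightarrow> 'b \<rightharpoonup> 'b" where
  "extend_along j X Y \<alpha> y =
     (if y \<in> j ` X then map_option j (\<alpha> (inv_into X j y)) else if y \<in> Y then Some y else None)"

text \<open>The missing or moved points of the extension are images under \<open>j\<close> of those
  of \<open>\<alpha>\<close>, hence finitely many, and \<open>\<alpha>\<close> can be recovered from
  the action on the copy of \<open>X\<close>.\<close>

lemma extend_along_mon:
  assumes j: "inj_on j X" and sub: "j ` X \<subseteq> Y"
  shows "extend_along j X Y \<in> mon (almost_identity_semigroup X) (almost_identity_semigroup Y)"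
proof -
  interpret X: almost_identity X .
  let ?h = "extend_along j X Y"
  have hj: "?h \<alpha> (j x) = map_option j (\<alpha> x)" if "x \<in> X" for x \<alpha>
    using that j by (simp add: extend_along_def)
  have hn: "?h \<alpha> y = (if y \<in> Y then Some y else None)" if "y \<notin> j ` X" for y \<alpha>
    using that by (simp add: extend_along_def)
  have closed: "?h \<alpha> \<in> carrier (almost_identity_semigroup Y)" if a: "\<alpha> \<in> carrier X.S" for \<alpha>
  proof -
    note d = X.carrierD[OF a]
    have "{y \<in> Y. ?h \<alpha> y \<noteq> Some y} \<subseteq> j ` {x \<in> X. \<alpha> x \<noteq> Some x}"
    proof
      fix y assume y: "y \<in> {y \<in> Y. ?h \<alpha> y \<noteq> Some y}"
      then have "y \<in> j ` X" using hn[of y \<alpha>] by (auto split: if_splits)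
      then obtain x where "x \<in> X" "y = j x" by blast
      then show "y \<in> j ` {x \<in> X. \<alpha> x \<noteq> Some x}" using y hj by fastforce
    qed
    then have "finite {y \<in> Y. ?h \<alpha> y \<noteq> Some y}" using d(4) by (meson finite_imageI finite_subset)
    \<comment> \<open>The copy of \<open>X\<close> and its complement in \<open>Y\<close> are each
      mapped into themselves, so injectivity can be checked on the two pieces separately.\<close>
    moreover have cases: "(\<exists>x z. x \<in> X \<and> z \<in> X \<and> y = j x \<and> w = j z \<and> \<alpha> x = Some z) \<or>
        (y \<notin> j ` X \<and> y \<in> Y \<and> w = y)" if "?h \<alpha> y = Some w" for y w
    proof (cases "y \<in> j ` X")
      case True
      then obtain x where x: "x \<in> X" "y = j x" by blast
      then have "map_option j (\<alpha> x) = Some w" using that hj by simp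
      then obtain z where "\<alpha> x = Some z" "w = j z" by auto
      then show ?thesis using x d(2) by blast
    next
      case False
      then show ?thesis using that hn[OF False, of \<alpha>] by (auto split: if_splits)
    qed
    moreover have "y = y'" if "?h \<alpha> y = Some w" "?h \<alpha> y' = Some w" for y y' w
      using cases[OF that(1)] cases[OF that(2)] j d(3) by (auto dest: inj_onD)
    ultimately show ?thesis
      unfolding almost_identity_carrier_iff using sub by blast
  qed
  moreover have "?h (\<beta> \<circ>\<^sub>m \<alpha>) = ?h \<beta> \<circ>\<^sub>m ?h \<alpha>" if a: "\<alpha> \<in> carrier X.S" for \<alpha> \<beta>
  proof
    fix y
    show "?h (\<beta> \<circ>\<^sub>m \<alpha>) y = (?h \<beta> \<circ>\<^sub>m ?h \<alpha>) y"
    proof (cases "y \<in> j ` X")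
      case True
      then obtain x where x: "x \<in> X" "y = j x" by blast
      \<comment> \<open>A value of \<open>\<alpha>\<close> at \<open>x\<close> lies again in
        \<open>X\<close>, so \<open>hj\<close> also evaluates the second factor.\<close>
      then show ?thesis
        using X.carrierD(2)[OF a, of x] by (cases "\<alpha> x") (simp_all add: hj)
    next
      case False
      then show ?thesis by (simp add: hn map_comp_def)
    qed
  qed
  moreover have "inj_on ?h (carrier X.S)"
  proof (rule inj_onI)
    fix \<alpha> \<beta> assume a: "\<alpha> \<in> carrier X.S" and b: "\<beta> \<in> carrier X.S" and eq: "?h \<alpha> = ?h \<beta>"
    show "\<alpha> = \<beta>"
    proof
      fix x
      show "\<alpha> x = \<beta> x"
      proof (cases "x \<in> X")
        case True
        then have m: "map_option j (\<alpha> x) = map_option j (\<beta> x)"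
          using fun_cong[OF eq, of "j x"] by (simp add: hj)
        show ?thesis
          using m X.carrierD(2)[OF a, of x] X.carrierD(2)[OF b, of x] j
          by (cases "\<alpha> x"; cases "\<beta> x") (auto dest: inj_onD)
      next
        case False
        then show ?thesis
          using X.carrierD(1)[OF a, of x] X.carrierD(1)[OF b, of x]
          by (cases "\<alpha> x"; cases "\<beta> x") auto
      qed
    qed
  qed
  ultimately show ?thesis
    by (simp add: mon_def hom_def)
qed

lemma almost_identity_semigroup_embedding:
  assumes "lam1 \<le>o lam2"
  shows "\<exists>h. h \<in> mon (almost_identity_semigroup (Field lam1)) (almost_identity_semigroup (Field lam2))"
proof -
  have "|Field lam1| \<le>o |Field lam2|"
    by (rule card_of_mono2[OF assms])
  then obtain j where "inj_on j (Field lam1)" "j ` Field lam1 \<subseteq> Field lam2"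
    by (auto simp: card_of_ordLeq[symmetric])
  then show ?thesis
    using extend_along_mon by blast
qed

theorem proposition2p2:
  fixes lam :: "'a rel"
  assumes "Cinfinite lam"
  shows
    "let L = Field lam;
         S = almost_identity_semigroup L;
         I = (\<lambda>n. {\<alpha> \<in> carrier S. n \<le> card (L - dom \<alpha>)})
     in
       (\<forall>\<alpha> \<in> carrier S. \<alpha> \<in> idempotents S \<longleftrightarrow> (\<forall>x \<in> dom \<alpha>. \<alpha> x = Some x)) \<and>
       (\<forall>\<epsilon> \<in> idempotents S. \<forall>\<iota> \<in> idempotents S. natural_le S \<epsilon> \<iota> \<longleftrightarrow> dom \<epsilon> \<subseteq> dom \<iota>) \<and>
       (\<lambda>\<epsilon>. L - dom \<epsilon>) \<in> iso (idempotent_semilattice S) (finite_subsets_semilattice L) \<and>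
       (\<forall>C. pred_on.maxchain (idempotents S) (natural_le S) C \<longrightarrow> is_omega_chain C (natural_le S)) \<and>
       (\<forall>\<alpha> \<in> carrier S. \<forall>\<beta> \<in> carrier S. (\<alpha>, \<beta>) \<in> green_R S \<longleftrightarrow> dom \<alpha> = dom \<beta>) \<and>
       (\<forall>\<alpha> \<in> carrier S. \<forall>\<beta> \<in> carrier S. (\<alpha>, \<beta>) \<in> green_L S \<longleftrightarrow> ran \<alpha> = ran \<beta>) \<and>
       (\<forall>\<alpha> \<in> carrier S. \<forall>\<beta> \<in> carrier S.
          (\<alpha>, \<beta>) \<in> green_H S \<longleftrightarrow> dom \<alpha> = dom \<beta> \<and> ran \<alpha> = ran \<beta>) \<and>
       (\<forall>\<alpha> \<in> carrier S. \<forall>\<beta> \<in> carrier S.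
          (\<alpha>, \<beta>) \<in> green_D S \<longleftrightarrow> card (L - dom \<alpha>) = card (L - dom \<beta>)) \<and>
       (\<forall>n. \<forall>\<alpha> \<in> carrier S. \<forall>\<beta> \<in> carrier S.
          card (L - dom \<alpha>) = n \<and> card (L - dom \<beta>) = n \<longrightarrow>
          (\<exists>\<gamma> \<in> carrier S. \<exists>\<delta> \<in> carrier S. \<alpha> = \<gamma> \<otimes>\<^bsub>S\<^esub> \<beta> \<otimes>\<^bsub>S\<^esub> \<delta> \<and>
             card (L - dom \<gamma>) = n \<and> card (L - dom \<delta>) = n)) \<and>
       ((\<forall>n. semigroup_ideal S (I n)) \<and> (\<forall>A. semigroup_ideal S A \<longrightarrow> (\<exists>n. A = I n))) \<and>
       green_D S = green_J S \<and>
       (\<forall>(lam1 :: 'b rel) (lam2 :: 'c rel).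
          Cinfinite lam1 \<and> Cinfinite lam2 \<and> lam1 \<le>o lam2 \<longrightarrow>
          (\<exists>h. h \<in> mon (almost_identity_semigroup (Field lam1))
                       (almost_identity_semigroup (Field lam2)))) \<and>
       is_omega_chain (carrier S // green_J S) (J_class_le S)"
proof -
  interpret almost_identity "Field lam" .
  have X: "infinite (Field lam)"
    using assms unfolding cinfinite_def by blast
  show ?thesis
    unfolding Let_def
  proof (intro conjI)
    show "\<forall>\<alpha> \<in> carrier S. \<forall>\<beta> \<in> carrier S.
        (\<alpha>, \<beta>) \<in> green_H S \<longleftrightarrow> dom \<alpha> = dom \<beta> \<and> ran \<alpha> = ran \<beta>"
      using green_L_iff green_R_iff by (auto simp: green_H_def)
    show "\<forall>n. \<forall>\<alpha> \<in> carrier S. \<forall>\<beta> \<in> carrier S. defect \<alpha> = n \<and> defect \<beta> = n \<longrightarrow>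
        (\<exists>\<gamma> \<in> carrier S. \<exists>\<delta> \<in> carrier S. \<alpha> = \<gamma> \<otimes>\<^bsub>S\<^esub> \<beta> \<otimes>\<^bsub>S\<^esub> \<delta> \<and> defect \<gamma> = n \<and> defect \<delta> = n)"
    proof (intro allI ballI impI)
      fix n \<alpha> \<beta> assume *: "\<alpha> \<in> carrier S" "\<beta> \<in> carrier S" "defect \<alpha> = n \<and> defect \<beta> = n"
      \<comment> \<open>Equal defects are a special case of the inequality in
        \<open>factorization\<close>, and both factors then have defect exactly
        \<open>n\<close>.\<close>
      then have "defect \<beta> \<le> defect \<alpha>" by simp
      then obtain \<gamma> \<delta> where gd: "\<gamma> \<in> carrier S" "\<delta> \<in> carrier S" "\<alpha> = \<gamma> \<otimes>\<^bsub>S\<^esub> \<beta> \<otimes>\<^bsub>S\<^esub> \<delta>"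
        "defect \<gamma> = defect \<beta>" "defect \<delta> = defect \<alpha>"
        by (rule factorization[OF *(1,2)])
      have "defect \<gamma> = n" "defect \<delta> = n" using gd(4,5) *(3) by simp_all
      then show "\<exists>\<gamma> \<in> carrier S. \<exists>\<delta> \<in> carrier S. \<alpha> = \<gamma> \<otimes>\<^bsub>S\<^esub> \<beta> \<otimes>\<^bsub>S\<^esub> \<delta> \<and> defect \<gamma> = n \<and> defect \<delta> = n"
        by (intro rev_bexI[OF gd(1)] rev_bexI[OF gd(2)] conjI gd(3))
    qed
    show "\<forall>\<alpha> \<in> carrier S. \<alpha> \<in> idempotents S \<longleftrightarrow> (\<forall>x \<in> dom \<alpha>. \<alpha> x = Some x)"
      by (intro ballI idempotents_iff)
    show "\<forall>\<epsilon> \<in> idempotents S. \<forall>\<iota> \<in> idempotents S. natural_le S \<epsilon> \<iota> \<longleftrightarrow> dom \<epsilon> \<subseteq> dom \<iota>"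
      by (intro ballI natural_le_iff)
    show "\<forall>C. pred_on.maxchain (idempotents S) (natural_le S) C \<longrightarrow> is_omega_chain C (natural_le S)"
      by (intro allI impI maxchain_omega_chain[OF X])
    show "\<forall>\<alpha> \<in> carrier S. \<forall>\<beta> \<in> carrier S. (\<alpha>, \<beta>) \<in> green_R S \<longleftrightarrow> dom \<alpha> = dom \<beta>"
      by (intro ballI green_R_iff)
    show "\<forall>\<alpha> \<in> carrier S. \<forall>\<beta> \<in> carrier S. (\<alpha>, \<beta>) \<in> green_L S \<longleftrightarrow> ran \<alpha> = ran \<beta>"
      by (intro ballI green_L_iff)
    show "\<forall>\<alpha> \<in> carrier S. \<forall>\<beta> \<in> carrier S. (\<alpha>, \<beta>) \<in> green_D S \<longleftrightarrow> defect \<alpha> = defect \<beta>"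
      by (intro ballI green_D_iff)
    show "\<forall>A. semigroup_ideal S A \<longrightarrow> (\<exists>n. A = {\<alpha> \<in> carrier S. n \<le> defect \<alpha>})"
      by (intro allI impI semigroup_ideal_eq_defect)
    show "\<forall>n. semigroup_ideal S {\<alpha> \<in> carrier S. n \<le> defect \<alpha>}"
      by (intro allI semigroup_ideal_defect[OF X])
    show "\<forall>(lam1 :: 'b rel) (lam2 :: 'c rel).
        Cinfinite lam1 \<and> Cinfinite lam2 \<and> lam1 \<le>o lam2 \<longrightarrow>
        (\<exists>h. h \<in> mon (almost_identity_semigroup (Field lam1)) (almost_identity_semigroup (Field lam2)))"
      by (intro allI impI almost_identity_semigroup_embedding) simp
  qed (fact idempotent_semilattice_iso green_D_eq_green_J J_classes_omega_chain[OF X])+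
qed

end
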